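(* Let $c\in\mathbb{C}$. Any central extension of $TSV(c)$ by a one-dimensional center $\mathbb{C}\mathfrak{c}$ is of the form $\widetilde{TSV(c)}=TSV(c)\oplus\mathbb{C}\mathfrak{c}$ with non-trivial $\lambda$-brackets $$[L_\lambda L]=(\partial+2\lambda)L+(a_1\lambda+a_3\lambda^3)\mathfrak{c},$$ $$[L_\lambda Y]=\left(\partial+\tfrac{3}{2}\lambda+c\right)Y+\left(\tfrac{2}{3}c+\lambda\right)b_1\mathfrak{c},$$ $$[Y_\lambda Y]=-(\partial+2\lambda)(\partial+2c)M-2c_0\lambda\,\mathfrak{c},$$ $$[L_\lambda M]=(\partial+2c)M+c_0\mathfrak{c},$$ where $a_1,a_3,b_1,c_0\in\mathbb{C}$.
   Context: A Lie conformal algebra $R$ is a $\mathbb{C}[\partial]$-module with a $\mathbb{C}$-bilinear $\lambda$-bracket $[\cdot_\lambda\cdot]:R\otimes R\to R[\lambda]$ such that for all $x,y,z\in R$: $[\partial x_\lambda y]=-\lambda[x_\lambda y]$, $[x_\lambda\partial y]=(\lambda+\partial)[x_\lambda y]$; $[x_\lambda y]=-[y_{-\lambda-\partial}x]$ (skew-symmetry); $[x_\lambda[y_\mu z]]=[[x_\lambda y]_{\lambda+\mu}z]+[y_\mu[x_\lambda z]]$ (Jacobi identity). For $c\in\mathbb{C}$, $TSV(c)=\mathbb{C}[\partial]L\oplus\mathbb{C}[\partial]M\oplus\mathbb{C}[\partial]Y$ is the Lie conformal algebra, free over $\mathbb{C}[\partial]$ with basis $L,M,Y$, with $\lambda$-brackets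 $$[L_\lambda L]=(\partial+2\lambda)L,\quad [L_\lambda Y]=\left(\partial+\tfrac{3}{2}\lambda+c\right)Y,\quad [L_\lambda M]=(\partial+2c)M,$$ $$[Y_\lambda Y]=(\partial+2\lambda)(-\partial-2c)M,\quad [Y_\lambda M]=[M_\lambda M]=0,$$ the remaining brackets of basis elements being determined by skew-symmetry. A central extension of a Lie conformal algebra $R$ by a one-dimensional center $\mathbb{C}\mathfrak{c}$ is a Lie conformal algebra $\widehat R=R\oplus\mathbb{C}\mathfrak{c}$ (direct sum of $\mathbb{C}[\partial]$-modules) with $\partial\mathfrak{c}=0$, $[\mathfrak{c}_\lambda\widehat R]=0$, and $[x_\lambda y]_{\widehat R}=[x_\lambda y]_R+\alpha_\lambda(x,y)\mathfrak{c}$ for all $x,y\in R$, where $\alpha_\lambda:R\times R\to\mathbb{C}[\lambda]$ is a $\mathbb{C}$-bilinear map. (The central element $\mathfrak{c}$ is not to be confused with the scalar $c$.) "Non-trivial $\lambda$-brackets" means: every bracket of two elements of $\{L,Y,M,\mathfrak{c}\}$ that is neither listed nor obtained from a listed one by skew-symmetry is zero. *)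

theory Defs
  imports Complex_Main "HOL-Library.Product_Plus" "HOL-Computational_Algebra.Polynomial"
begin

(* A C[d]-module is a module over the ring complex poly, where d (the derivation) is the
   polynomial variable [:0, 1:].  For a C[d]-module R of type 'r, R[lambda] is 'r poly. *)

abbreviation deriv_var :: "complex poly" where
  "deriv_var \<equiv> [:0, 1:]"

(* C[d, lambda] is complex poly poly: inner variable d, outer variable lambda. *)

abbreviation dd :: "complex poly poly" where
  "dd \<equiv> [:deriv_var:]"

abbreviation lam :: "complex poly poly" where
  "lam \<equiv> [:0, 1:]"

abbreviation cst :: "complex \<Rightarrow> complex poly poly" where
  "cst k \<equiv> [:[:k:]:]"

(* The element f(d, lambda) v of R[lambda], for f in C[d, lambda] and v in R. *)

definition pact ::
  "complex poly poly \<Rightarrow> (complex poly \<Rightarrow> 'r::ab_group_add \<Rightarrow> 'r) \<Rightarrow> 'r \<Rightarrow> 'r poly"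
  ("(_ \<odot>\<^bsub>_\<^esub> _)" [71, 0, 71] 70) where
  "f \<odot>\<^bsub>scale\<^esub> v = map_poly (\<lambda>p. scale p v) f"

(* subst_op T f p is the sum of T^n (f r_n) for p = sum of lambda^n r_n, i.e. the operator T is
   substituted for lambda, and the coefficients are mapped by f. *)

definition subst_op ::
  "('v \<Rightarrow> 'v) \<Rightarrow> ('r \<Rightarrow> 'v) \<Rightarrow> 'r::zero poly \<Rightarrow> 'v::comm_monoid_add" where
  "subst_op T f p = (\<Sum>n\<le>degree p. (T ^^ n) (f (coeff p n)))"

(* R[lambda, mu] is 'r poly poly with inner variable lambda and outer variable mu. *)

definition mul_lam :: "'r::ab_group_add poly poly \<Rightarrow> 'r poly poly" where
  "mul_lam P = map_poly (pCons 0) P"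

definition mul_mu :: "'r::ab_group_add poly poly \<Rightarrow> 'r poly poly" where
  "mul_mu P = pCons 0 P"

definition const2 :: "'r::ab_group_add \<Rightarrow> 'r poly poly" where
  "const2 r = [:[:r:]:]"

abbreviation bilinear_over_C ::
  "(complex \<Rightarrow> 'a::ab_group_add \<Rightarrow> 'a) \<Rightarrow> (complex \<Rightarrow> 'b::ab_group_add \<Rightarrow> 'b) \<Rightarrow>
   ('a \<Rightarrow> 'a \<Rightarrow> 'b) \<Rightarrow> bool" where
  "bilinear_over_C s t f \<equiv>
     (\<forall>y. Vector_Spaces.linear s t (\<lambda>x. f x y)) \<and> (\<forall>x. Vector_Spaces.linear s t (f x))"

locale lie_conformal_algebra = module scale
  for scale :: "complex poly \<Rightarrow> 'r::ab_group_add \<Rightarrow> 'r" +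
  fixes bracket :: "'r \<Rightarrow> 'r \<Rightarrow> 'r poly"
  assumes bilinear:
    "bilinear_over_C (\<lambda>k. scale [:k:]) (\<lambda>k. map_poly (scale [:k:])) bracket"
  and sesquilinear_left:
    "bracket (scale deriv_var x) y = - pCons 0 (bracket x y)"
  and sesquilinear_right:
    "bracket x (scale deriv_var y) = pCons 0 (bracket x y) + map_poly (scale deriv_var) (bracket x y)"
  and skew_symmetry:
    "bracket x y =
       - subst_op (\<lambda>p. - pCons 0 p - map_poly (scale deriv_var) p) (\<lambda>r. [:r:]) (bracket y x)"
  and jacobi:
    "subst_op mul_mu (\<lambda>r. subst_op mul_lam const2 (bracket x r)) (bracket y z) =
       subst_op mul_lam (\<lambda>r. subst_op (\<lambda>P. mul_lam P + mul_mu P) const2 (bracket r z)) (bracket x y)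
     + subst_op mul_lam (\<lambda>r. subst_op mul_mu const2 (bracket y r)) (bracket x z)"

locale TSV = lie_conformal_algebra scale bracket
  for scale :: "complex poly \<Rightarrow> 'r::ab_group_add \<Rightarrow> 'r"
  and bracket :: "'r \<Rightarrow> 'r \<Rightarrow> 'r poly" +
  fixes c :: complex and L M Y :: 'r
  assumes distinct_basis: "distinct [L, M, Y]"
  and independent_basis: "independent {L, M, Y}"
  and span_basis: "span {L, M, Y} = UNIV"
  and LL: "bracket L L = (dd + 2 * lam) \<odot>\<^bsub>scale\<^esub> L"
  and LY: "bracket L Y = (dd + cst (3/2) * lam + cst c) \<odot>\<^bsub>scale\<^esub> Y"
  and LM: "bracket L M = (dd + cst (2 * c)) \<odot>\<^bsub>scale\<^esub> M"
  and YY: "bracket Y Y = ((dd + 2 * lam) * (- dd - cst (2 * c))) \<odot>\<^bsub>scale\<^esub> M"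
  and YM: "bracket Y M = 0"
  and MM: "bracket M M = 0"

(* The C[d]-module R + C cc, where cc = (0, 1) and d cc = 0. *)

definition ext_scale ::
  "(complex poly \<Rightarrow> 'r \<Rightarrow> 'r) \<Rightarrow> complex poly \<Rightarrow> 'r \<times> complex \<Rightarrow> 'r \<times> complex" where
  "ext_scale scale p = (\<lambda>(x, k). (scale p x, poly p 0 * k))"

abbreviation incl :: "'r \<Rightarrow> 'r \<times> complex" where
  "incl x \<equiv> (x, 0)"

abbreviation cc :: "'r::zero \<times> complex" where
  "cc \<equiv> (0, 1)"

locale central_extension = lie_conformal_algebra scale bracket +
  hat: lie_conformal_algebra "ext_scale scale" hat_bracket
  for scale :: "complex poly \<Rightarrow> 'r::ab_group_add \<Rightarrow> 'r"
  and bracket :: "'r \<Rightarrow> 'r \<Rightarrow> 'r poly"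
  and hat_bracket :: "'r \<times> complex \<Rightarrow> 'r \<times> complex \<Rightarrow> ('r \<times> complex) poly" +
  fixes \<alpha> :: "'r \<Rightarrow> 'r \<Rightarrow> complex poly"
  assumes cocycle_bilinear: "bilinear_over_C (\<lambda>k. scale [:k:]) smult \<alpha>"
  and central: "hat_bracket cc w = 0"
  and hat_bracket_incl:
    "hat_bracket (incl x) (incl y) =
       map_poly incl (bracket x y) + map_poly (\<lambda>k. (0, k)) (\<alpha> x y)"

end

theory Submission
  imports Defs
begin

text \<open>
  Evaluating the central component of the extended bracket at a complex number turns the Jacobi
  identity into a functional equation for the polynomials \<open>\<alpha> x y\<close>.
  For \<open>\<alpha> L L\<close>, \<open>\<alpha> L Y\<close> and \<open>\<alpha> L M\<close> the Jacobi identities on \<open>(L, L, _)\<close> give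
  the equation \<open>(l + b m + d) f(l) = (l - m) f(l + m) + (m + b l + d) f(m)\<close> with
  \<open>b = 2, 3/2, 0\<close>; its derivative in \<open>m\<close> at \<open>m = 0\<close> is an Euler equation that leaves only the
  coefficients of degree 0, 1 and \<open>b + 1\<close>. The identity on \<open>(L, Y, Y)\<close> at \<open>m = 0\<close> gives
  \<open>\<alpha> Y Y = -2 l (\<alpha> L M)\<close>, and since \<open>\<alpha> Y Y\<close> is odd, the linear coefficient of
  \<open>\<alpha> L M\<close> vanishes (for \<open>c = 0\<close> this does not follow from \<open>(L, L, M)\<close>). The identities on
  \<open>(L, Y, M)\<close> and \<open>(L, M, M)\<close> at \<open>l = 0\<close> and at \<open>m = 0\<close> kill \<open>\<alpha> Y M\<close> and \<open>\<alpha> M M\<close>.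
\<close>

section \<open>Evaluating polynomials over a group at a complex number\<close>

definition ev :: "('a::zero \<Rightarrow> complex) \<Rightarrow> complex \<Rightarrow> 'a poly \<Rightarrow> complex" where
  "ev \<phi> t p = poly (map_poly \<phi> p) t"

lemma ev_eq_sum:
  assumes "\<phi> 0 = 0" "degree p \<le> N"
  shows "ev \<phi> t p = (\<Sum>n\<le>N. t ^ n * \<phi> (coeff p n))"
proof -
  have "degree (map_poly \<phi> p) \<le> N"
    using assms by (intro degree_le) (auto simp: coeff_map_poly coeff_eq_0)
  then have "poly (map_poly \<phi> p) t = (\<Sum>n\<le>N. coeff (map_poly \<phi> p) n * t ^ n)"
    unfolding poly_altdef
    by (intro sum.mono_neutral_left) (auto simp: coeff_eq_0)
  then show ?thesis
    using assms by (simp add: ev_def coeff_map_poly mult.commute)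
qed

lemma ev_map_poly: "g 0 = 0 \<Longrightarrow> \<phi> 0 = 0 \<Longrightarrow> ev \<phi> t (map_poly g p) = ev (\<lambda>r. \<phi> (g r)) t p"
  by (simp add: ev_def map_poly_map_poly o_def)

lemma ev_cmult: "\<phi> 0 = 0 \<Longrightarrow> ev (\<lambda>r. k * \<phi> r) t p = k * ev \<phi> t p"
  by (simp add: ev_eq_sum[OF _ order_refl] sum_distrib_left mult.left_commute)

lemma ev_pCons: "\<phi> 0 = 0 \<Longrightarrow> ev \<phi> t (pCons a p) = \<phi> a + t * ev \<phi> t p"
  by (simp add: ev_def map_poly_pCons)

lemma ev_add:
  assumes "additive \<phi>"
  shows "ev \<phi> t (p + q) = ev \<phi> t p + ev \<phi> t q"
proof -
  interpret additive \<phi> by fact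
  have "map_poly \<phi> (p + q) = map_poly \<phi> p + map_poly \<phi> q"
    by (intro poly_eqI) (simp add: coeff_map_poly zero add)
  then show ?thesis by (simp add: ev_def)
qed

lemma additive_ev: "additive \<phi> \<Longrightarrow> additive (ev \<phi> t)"
  by (simp add: additive_def ev_add)

text \<open>Once \<open>E\<close> turns the operator \<open>T\<close> into multiplication by
  \<open>t\<close>, substituting \<open>T\<close> for \<lambda> is plain evaluation at
  \<open>t\<close>. This one principle handles skew-symmetry and all three terms of the Jacobi
  identity.\<close>

lemma ev_subst_op:
  fixes E :: "'v::ab_group_add \<Rightarrow> complex"
  assumes "additive E" and T: "\<And>v. E (T v) = t * E v" and f0: "E (f 0) = 0"
  shows "E (subst_op T f p) = ev (\<lambda>r. E (f r)) t p"
proof -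
  interpret additive E by fact
  have "E ((T ^^ n) v) = t ^ n * E v" for n v
    by (induction n) (simp_all add: T mult.assoc)
  then show ?thesis
    by (simp add: subst_op_def sum ev_eq_sum[of "\<lambda>r. E (f r)", OF f0 order_refl])
qed

text \<open>In a polynomial in \<lambda> and \<mu> the outer variable is \<mu>, so the nested
  \<open>ev\<close> sets \<lambda> to \<open>l\<close> inside and \<mu> to \<open>m\<close>
  outside.\<close>

lemma ev_mul_lam:
  assumes "additive \<phi>"
  shows "ev (ev \<phi> l) m (mul_lam P) = l * ev (ev \<phi> l) m P"
proof -
  have 0: "\<phi> 0 = 0" using assms by (rule additive.zero)
  have 1: "ev \<phi> l 0 = 0" by (simp add: ev_def)
  show ?thesis
    unfolding mul_lam_def
    by (simp add: ev_map_poly 1 ev_pCons 0 ev_cmult)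
qed

lemma ev_mul_mu: "ev (ev \<phi> l) m (mul_mu P) = m * ev (ev \<phi> l) m P"
  unfolding mul_mu_def by (subst ev_pCons) (simp_all add: ev_def)

lemma ev_const2: "\<phi> 0 = 0 \<Longrightarrow> ev (ev \<phi> l) m (const2 r) = \<phi> r"
  by (simp add: const2_def ev_def map_poly_pCons)

lemma ev_pact:
  assumes "\<And>p. \<phi> (scale p v) = poly p s * \<phi> v" "scale 0 v = 0" "\<phi> 0 = 0"
  shows "ev \<phi> t (f \<odot>\<^bsub>scale\<^esub> v) = poly (poly f [:t:]) s * \<phi> v"
proof -
  have "ev \<phi> t (f \<odot>\<^bsub>scale\<^esub> v) = ev (\<lambda>p. poly p s * \<phi> v) t f"
    by (simp add: pact_def ev_map_poly assms)
  also have "\<dots> = poly (poly f [:t:]) s * \<phi> v"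
    by (induction f) (simp_all add: ev_pCons, simp_all add: ev_def algebra_simps)
  finally show ?thesis .
qed

lemma additive_snd: "additive (snd :: 'r::ab_group_add \<times> complex \<Rightarrow> complex)"
  by (simp add: additive_def)

section \<open>The central component of the extended bracket\<close>

context central_extension
begin

definition B :: "'r \<times> complex \<Rightarrow> 'r \<times> complex \<Rightarrow> complex \<Rightarrow> complex" where
  "B x y l = ev snd l (hat_bracket x y)"

lemma snd_ext_scale: "snd (ext_scale scale p v) = poly p 0 * snd v"
  by (simp add: ext_scale_def split: prod.split)

lemma hat_bracket_add_left: "hat_bracket (x + x') y = hat_bracket x y + hat_bracket x' y"
  and hat_bracket_add_right: "hat_bracket x (y + y') = hat_bracket x y + hat_bracket x y'"
  and hat_bracket_scale_left:
    "hat_bracket (ext_scale scale [:k:] x) y = map_poly (ext_scale scale [:k:]) (hat_bracket x y)"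
  and hat_bracket_scale_right:
    "hat_bracket x (ext_scale scale [:k:] y) = map_poly (ext_scale scale [:k:]) (hat_bracket x y)"
  using hat.bilinear unfolding Vector_Spaces.linear_iff by blast+

lemma additive_B_left: "additive (\<lambda>x. B x y l)"
  and additive_B_right: "additive (\<lambda>y. B x y l)"
  by (simp_all add: additive_def B_def hat_bracket_add_left hat_bracket_add_right
      ev_add[OF additive_snd])

lemmas B_zero_left = additive.zero[OF additive_B_left]
lemmas B_zero_right = additive.zero[OF additive_B_right]

lemma ev_snd_ext_scale:
  "ev snd l (map_poly (ext_scale scale p) q) = poly p 0 * ev snd l q"
  by (simp add: ev_map_poly snd_ext_scale ev_cmult hat.scale_zero_right)

lemma ext_scale_pCons:
  "ext_scale scale (pCons a p) x =
     ext_scale scale [:a:] x + ext_scale scale deriv_var (ext_scale scale p x)"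
proof -
  have "pCons a p = [:a:] + deriv_var * p" by simp
  then show ?thesis by (simp only: hat.scale_left_distrib hat.scale_scale)
qed

text \<open>Since \<partial> kills the center, the factor \<lambda> + \<partial> of right
  sesquilinearity acts on the central component as \<lambda> alone. Horner's scheme passes from
  \<partial> to \<open>p\<close>.\<close>

lemma B_scale_right: "B x (ext_scale scale p y) l = poly p l * B x y l"
proof (induction p)
  case 0
  then show ?case by (simp add: hat.scale_zero_left B_zero_right)
next
  case (pCons a p)
  have "B x (ext_scale scale deriv_var z) l = l * B x z l" for z
    by (simp add: B_def hat.sesquilinear_right ev_add[OF additive_snd] ev_snd_ext_scale ev_pCons)
  moreover have "B x (ext_scale scale [:a:] y) l = a * B x y l"
    by (simp add: B_def hat_bracket_scale_right ev_snd_ext_scale)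
  ultimately show ?case
    by (simp add: ext_scale_pCons[of a p] additive.add[OF additive_B_right] pCons algebra_simps
        del: hat.scale_scale)
qed

lemma B_scale_left: "B (ext_scale scale p x) y l = poly p (- l) * B x y l"
proof (induction p)
  case 0
  then show ?case by (simp add: hat.scale_zero_left B_zero_left)
next
  case (pCons a p)
  have "B (ext_scale scale deriv_var z) y l = - l * B z y l" for z
    by (simp add: B_def hat.sesquilinear_left additive.minus[OF additive_ev[OF additive_snd]] ev_pCons
        del: minus_pCons)
  moreover have "B (ext_scale scale [:a:] x) y l = a * B x y l"
    by (simp add: B_def hat_bracket_scale_left ev_snd_ext_scale)
  ultimately show ?case
    by (simp add: ext_scale_pCons[of a p] additive.add[OF additive_B_left] pCons algebra_simps
        del: hat.scale_scale)
qed

text \<open>On the central component \<partial> acts as 0, so the substitution of -\<lambda> -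
  \<partial> becomes evaluation at \<open>- l\<close>.\<close>

lemma B_skew: "B x y l = - B y x (- l)"
proof -
  note add = additive_ev[OF additive_snd, where t = l]
  have "ev snd l (subst_op (\<lambda>p. - pCons 0 p - map_poly (ext_scale scale deriv_var) p)
      (\<lambda>r. [:r:]) (hat_bracket y x)) = ev (\<lambda>r. ev snd l [:r:]) (- l) (hat_bracket y x)"
    by (rule ev_subst_op[OF add])
      (simp_all add: additive.diff[OF add] additive.minus[OF add] ev_snd_ext_scale ev_pCons
        additive.zero[OF add] del: minus_pCons)
  then show ?thesis
    by (simp add: B_def hat.skew_symmetry[of x y] additive.minus[OF add] ev_pCons
        additive.zero[OF add])
qed

text \<open>Only the outer brackets are reduced to their central component. The inner ones stay
  whole, because their components in \<open>R\<close> still contribute to the outer bracket.\<close>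

lemma B_jacobi:
  "ev (\<lambda>r. B x r l) m (hat_bracket y z) =
     ev (\<lambda>r. B r z (l + m)) l (hat_bracket x y) + ev (\<lambda>r. B y r m) l (hat_bracket x z)"
proof -
  let ?E = "ev (ev snd l) m :: ('r \<times> complex) poly poly \<Rightarrow> complex"
  have E: "additive ?E" by (intro additive_ev additive_snd)
  have lam: "?E (subst_op mul_lam f p) = ev (\<lambda>r. ?E (f r)) l p" if "?E (f 0) = 0"
    for f and p :: "('r \<times> complex) poly"
    using that by (intro ev_subst_op[OF E] ev_mul_lam additive_snd)
  have mu: "?E (subst_op mul_mu f p) = ev (\<lambda>r. ?E (f r)) m p" if "?E (f 0) = 0"
    for f and p :: "('r \<times> complex) poly"
    using that by (intro ev_subst_op[OF E] ev_mul_mu)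
  have lm: "?E (subst_op (\<lambda>P. mul_lam P + mul_mu P) f p) = ev (\<lambda>r. ?E (f r)) (l + m) p"
    if "?E (f 0) = 0" for f and p :: "('r \<times> complex) poly"
    using that
    by (intro ev_subst_op[OF E])
      (simp_all add: additive.add[OF E] ev_mul_lam[OF additive_snd] ev_mul_mu algebra_simps)
  have B1: "?E (subst_op mul_lam const2 (hat_bracket u v)) = B u v l" for u v
    by (simp add: lam ev_const2 B_def)
  have B2: "?E (subst_op mul_mu const2 (hat_bracket u v)) = B u v m" for u v
    by (simp add: mu ev_const2 B_def)
  have B3: "?E (subst_op (\<lambda>P. mul_lam P + mul_mu P) const2 (hat_bracket u v)) = B u v (l + m)"
    for u v
    by (simp add: lm ev_const2 B_def)
  show ?thesis
    using arg_cong[OF hat.jacobi[of x y z], of ?E]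
    by (simp add: additive.add[OF E] lam mu B1 B2 B3 B_zero_left B_zero_right)
qed

lemma B_cc_left: "B cc y l = 0"
  by (simp add: B_def central ev_def)

lemma B_cc_right: "B x cc l = 0"
  using B_skew[of x cc l] by (simp add: B_cc_left)

lemma hat_bracket_swap_eq_0: "hat_bracket y x = 0 \<Longrightarrow> hat_bracket x y = 0"
  by (simp add: hat.skew_symmetry[of x y] subst_op_def)

text \<open>Regards a polynomial in \<lambda> as one in \<partial> and \<lambda> that is constant in
  \<partial>, so that the cocycle term can be written as an action on \<open>cc\<close>.\<close>

definition lift :: "complex poly \<Rightarrow> complex poly poly" where
  "lift q = map_poly (\<lambda>k. [:k:]) q"

lemma hat_bracket_pact:
  assumes "bracket x y = f \<odot>\<^bsub>scale\<^esub> v"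
  shows "hat_bracket (incl x) (incl y) =
    f \<odot>\<^bsub>ext_scale scale\<^esub> incl v + lift (\<alpha> x y) \<odot>\<^bsub>ext_scale scale\<^esub> cc"
  unfolding hat_bracket_incl assms
  by (intro poly_eqI) (simp add: pact_def lift_def coeff_map_poly ext_scale_def zero_prod_def)

lemma B_incl: "B (incl x) (incl y) l = poly (\<alpha> x y) l"
proof -
  have "ev snd l (map_poly incl (bracket x y)) = ev (\<lambda>r. 0) l (bracket x y)"
    by (simp add: ev_map_poly zero_prod_def)
  also have "\<dots> = 0" by (simp add: ev_eq_sum[OF _ order_refl])
  moreover have "ev snd l (map_poly (\<lambda>k. (0, k)) (\<alpha> x y)) = poly (\<alpha> x y) l"
    by (simp add: ev_map_poly zero_prod_def) (simp add: ev_def)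
  ultimately show ?thesis
    by (simp add: B_def hat_bracket_incl ev_add[OF additive_snd])
qed

lemma alpha_skew: "poly (\<alpha> x y) l = - poly (\<alpha> y x) (- l)"
  using B_skew[of "incl x" "incl y" l] by (simp add: B_incl)

text \<open>The central parts of the inner brackets vanish under a further bracket. What remains is
  a multiple of one vector, on which \<partial> acts as the outer parameter in the right slot and as
  its negative in the left slot.\<close>

lemma alpha_jacobi:
  assumes "bracket y z = f \<odot>\<^bsub>scale\<^esub> u" "bracket x y = g \<odot>\<^bsub>scale\<^esub> v" "bracket x z = h \<odot>\<^bsub>scale\<^esub> w"
  shows "poly (poly f [:m:]) l * poly (\<alpha> x u) l =
    poly (poly g [:l:]) (- (l + m)) * poly (\<alpha> v z) (l + m)
    + poly (poly h [:l:]) m * poly (\<alpha> y w) m"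
  using B_jacobi[of "incl x" l m "incl y" "incl z"]
  unfolding hat_bracket_pact[OF assms(1)] hat_bracket_pact[OF assms(2)] hat_bracket_pact[OF assms(3)]
    ev_add[OF additive_B_left] ev_add[OF additive_B_right]
  by (simp add: ev_pact[where s = l] ev_pact[where s = m] ev_pact[where s = "- (l + m)"]
      B_scale_left B_scale_right B_zero_left B_zero_right B_cc_left B_cc_right B_incl
      hat.scale_zero_left)

end

section \<open>The functional equation and its Euler equation\<close>

lemma virasoro_functional_equation:
  fixes f :: "complex poly"
  assumes eq: "\<And>l m. (l + b * m + d) * poly f l =
    (l - m) * poly f (l + m) + (m + b * l + d) * poly f m"
  shows "b * coeff f 0 = d * coeff f 1"
    and "n \<ge> 2 \<Longrightarrow> b + 1 \<noteq> of_nat n \<Longrightarrow> coeff f n = 0"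
proof -
  \<comment> \<open>This is the difference of the two sides of the equation differentiated at m = 0.
    Its coefficient of degree n \<ge> 2 is b + 1 - n times that of \<open>f\<close>, its linear
    coefficient cancels, and its constant coefficient is the difference in the first claim.\<close>
  define g where "g = smult (b + 1) f - pCons 0 (pderiv f) - [:coeff f 0 + d * coeff f 1, b * coeff f 1:]"
  have "poly g l = 0" for l
  proof -
    have "((\<lambda>m. (l + b * m + d) * poly f l) has_field_derivative b * poly f l) (at 0)"
      by (auto intro!: derivative_eq_intros)
    moreover have "((\<lambda>m. (l - m) * poly f (l + m) + (m + b * l + d) * poly f m) has_field_derivative
        l * poly (pderiv f) l - poly f l + (poly f 0 + (b * l + d) * poly (pderiv f) 0)) (at 0)"
      by (auto intro!: derivative_eq_intros DERIV_chain2[OF poly_DERIV] poly_DERIV)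
    ultimately have "b * poly f l =
        l * poly (pderiv f) l - poly f l + (poly f 0 + (b * l + d) * poly (pderiv f) 0)"
      by (intro DERIV_unique[of "\<lambda>m. (l + b * m + d) * poly f l" _ 0]) (simp_all only: eq[of l])
    then show ?thesis
      by (simp add: g_def poly_0_coeff_0 coeff_pderiv algebra_simps)
  qed
  then have g: "g = 0" by (metis poly_0 poly_eq_poly_eq_iff ext)
  show "b * coeff f 0 = d * coeff f 1"
    using arg_cong[OF g, of "\<lambda>p. coeff p 0"] by (simp add: g_def algebra_simps)
  assume "n \<ge> 2" "b + 1 \<noteq> of_nat n"
  moreover obtain k where "n = Suc (Suc k)"
    using \<open>n \<ge> 2\<close> by (metis add_2_eq_Suc le_Suc_ex)
  ultimately show "coeff f n = 0"
    using arg_cong[OF g, of "\<lambda>p. coeff p n"]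
    by (auto simp add: g_def coeff_pderiv diff_eq_eq simp flip: left_diff_distrib)
qed

section \<open>The cocycle on the basis of TSV(c)\<close>

locale TSV_central_extension =
  TSV scale bracket c L M Y + central_extension scale bracket hat_bracket \<alpha>
  for scale :: "complex poly \<Rightarrow> 'r::ab_group_add \<Rightarrow> 'r"
  and bracket c L M Y hat_bracket \<alpha>
begin

text \<open>The coefficient of the value at \<open>l + m\<close> has \<partial> replaced by
  \<open>- (l + m)\<close>; here \<open>l - m\<close> is \<open>- (l + m) + 2 * l\<close>. The same
  holds in the identities below.\<close>

lemma LLL: "(l + 2 * m) * poly (\<alpha> L L) l =
    (l - m) * poly (\<alpha> L L) (l + m) + (m + 2 * l) * poly (\<alpha> L L) m"
  using alpha_jacobi[OF LL LL LL, of m l] by (simp add: algebra_simps)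

lemma LLY: "(l + 3/2 * m + c) * poly (\<alpha> L Y) l =
    (l - m) * poly (\<alpha> L Y) (l + m) + (m + 3/2 * l + c) * poly (\<alpha> L Y) m"
  using alpha_jacobi[OF LY LL LY, of m l] by (simp add: algebra_simps)

lemma LLM: "(l + 2 * c) * poly (\<alpha> L M) l =
    (l - m) * poly (\<alpha> L M) (l + m) + (m + 2 * c) * poly (\<alpha> L M) m"
  using alpha_jacobi[OF LM LL LM, of m l] by (simp add: algebra_simps)

lemma LYY: "- ((l + 2 * m) * (l + 2 * c)) * poly (\<alpha> L M) l =
    (l / 2 - m + c) * poly (\<alpha> Y Y) (l + m) + (m + 3/2 * l + c) * poly (\<alpha> Y Y) m"
  using alpha_jacobi[OF YY LY LY, of m l] by (simp add: algebra_simps)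

lemma LYM: "(l / 2 - m + c) * poly (\<alpha> Y M) (l + m) + (m + 2 * c) * poly (\<alpha> Y M) m = 0"
  \<comment> \<open>The vanishing inner bracket is presented as the zero polynomial acting on
    0.\<close>
  using alpha_jacobi[of Y M 0 0, OF _ LY LM, of m l] by (simp add: YM pact_def algebra_simps)

lemma LMM: "(- l - m + 2 * c) * poly (\<alpha> M M) (l + m) + (m + 2 * c) * poly (\<alpha> M M) m = 0"
  using alpha_jacobi[of M M 0 0, OF _ LM LM, of m l] by (simp add: MM pact_def algebra_simps)

lemma alpha_LL: "\<alpha> L L = [:0, coeff (\<alpha> L L) 1, 0, coeff (\<alpha> L L) 3:]"
proof (rule poly_eqI)
  fix n
  have eq: "(l + 2 * m + 0) * poly (\<alpha> L L) l =
      (l - m) * poly (\<alpha> L L) (l + m) + (m + 2 * l + 0) * poly (\<alpha> L L) m" for l m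
    using LLL[of l m] by simp
  have "(2 :: complex) + 1 \<noteq> of_nat n" if "n \<noteq> 3"
  proof -
    have "(2 :: complex) + 1 = of_nat 3" by simp
    with that show ?thesis by (simp only: of_nat_eq_iff)
  qed
  then have "coeff (\<alpha> L L) 0 = 0" "n \<ge> 2 \<Longrightarrow> n \<noteq> 3 \<Longrightarrow> coeff (\<alpha> L L) n = 0"
    using virasoro_functional_equation(1)[OF eq] virasoro_functional_equation(2)[OF eq] by auto
  then show "coeff (\<alpha> L L) n = coeff [:0, coeff (\<alpha> L L) 1, 0, coeff (\<alpha> L L) 3:] n"
    by (auto simp: coeff_pCons numeral_3_eq_3 numeral_2_eq_2 split: nat.split)
qed

lemma alpha_LY: "\<alpha> L Y = [:2/3 * c * coeff (\<alpha> L Y) 1, coeff (\<alpha> L Y) 1:]"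
proof (rule poly_eqI)
  fix n
  \<comment> \<open>The exceptional degree b + 1 = 5/2 is not an integer, so nothing of degree at
    least 2 survives.\<close>
  have "(3::complex) / 2 + 1 \<noteq> of_nat n"
  proof
    assume "(3::complex) / 2 + 1 = of_nat n"
    then have "of_nat 5 = (of_nat (2 * n) :: complex)" by (simp add: field_simps)
    then have "5 = 2 * n" by (simp only: of_nat_eq_iff)
    then show False by presburger
  qed
  then have "n \<ge> 2 \<Longrightarrow> coeff (\<alpha> L Y) n = 0"
    using virasoro_functional_equation(2)[OF LLY] by blast
  moreover have "coeff (\<alpha> L Y) 0 = 2/3 * c * coeff (\<alpha> L Y) 1"
    using virasoro_functional_equation(1)[OF LLY] by (simp add: field_simps)
  ultimately show "coeff (\<alpha> L Y) n = coeff [:2/3 * c * coeff (\<alpha> L Y) 1, coeff (\<alpha> L Y) 1:] n"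
    by (auto simp: coeff_pCons numeral_2_eq_2 split: nat.split)
qed

text \<open>At m = 0 both remaining terms of \<open>LYY\<close> contain the factor l + 2c; the
  hypothesis allows cancelling it.\<close>

lemma poly_alpha_YY:
  assumes "l + 2 * c \<noteq> 0"
  shows "poly (\<alpha> Y Y) l = - 2 * l * poly (\<alpha> L M) l"
proof -
  \<comment> \<open>An odd function vanishes at 0, which removes the last term of \<open>LYY\<close>
    at m = 0.\<close>
  have "poly (\<alpha> Y Y) 0 = 0" using alpha_skew[of Y Y 0] by simp
  then have "(l / 2 + c) * poly (\<alpha> Y Y) l - - (l * (l + 2 * c)) * poly (\<alpha> L M) l = 0"
    using LYY[of l 0] by simp
  moreover have "(l + 2 * c) * (poly (\<alpha> Y Y) l + 2 * l * poly (\<alpha> L M) l) =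
      2 * ((l / 2 + c) * poly (\<alpha> Y Y) l - - (l * (l + 2 * c)) * poly (\<alpha> L M) l)"
    by (simp add: algebra_simps)
  ultimately have "(l + 2 * c) * (poly (\<alpha> Y Y) l + 2 * l * poly (\<alpha> L M) l) = 0"
    by (simp only: mult_zero_right)
  with assms have "poly (\<alpha> Y Y) l + 2 * l * poly (\<alpha> L M) l = 0"
    by (simp only: mult_eq_0_iff) blast
  then show ?thesis by (simp only: eq_neg_iff_add_eq_0 mult_minus_left)
qed

lemma alpha_LM: "\<alpha> L M = [:coeff (\<alpha> L M) 0:]"
proof -
  define h0 h1 where "h0 = coeff (\<alpha> L M) 0" and "h1 = coeff (\<alpha> L M) 1"
  have h: "\<alpha> L M = [:h0, h1:]"
  proof (rule poly_eqI)
    fix n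
    have "(l + 0 * m + 2 * c) * poly (\<alpha> L M) l =
        (l - m) * poly (\<alpha> L M) (l + m) + (m + 0 * l + 2 * c) * poly (\<alpha> L M) m" for l m
      using LLM[of l m] by simp
    from virasoro_functional_equation(2)[OF this]
    moreover have "(0 :: complex) + 1 \<noteq> of_nat n" if "n \<ge> 2"
      using that of_nat_eq_iff[of 1 n, where 'a = complex] by auto
    ultimately have "coeff (\<alpha> L M) n = 0" if "n \<ge> 2"
      using that by blast
    then show "coeff (\<alpha> L M) n = coeff [:h0, h1:] n"
      by (auto simp: coeff_pCons h0_def h1_def numeral_2_eq_2 split: nat.split)
  qed
  \<comment> \<open>Both \<open>l\<close> and \<open>- l\<close> must avoid the exceptional point
    -2c of \<open>poly_alpha_YY\<close>. Comparing the two values then gives 4 l^2 h1 = 0, and l is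
    nonzero.\<close>
  obtain l :: complex where l: "l \<notin> {0, - 2 * c, 2 * c}"
    using ex_new_if_finite[OF infinite_UNIV_char_0, of "{0, - 2 * c, 2 * c}"] by auto
  then have "l + 2 * c \<noteq> 0" "- l + 2 * c \<noteq> 0" by (auto simp: add_eq_0_iff)
  then have "- 2 * l * (h0 + l * h1) = - (2 * l * (h0 - l * h1))"
    using alpha_skew[of Y Y l] poly_alpha_YY[of l] poly_alpha_YY[of "- l"] by (simp add: h)
  then have "h1 = 0" using l by (simp add: algebra_simps)
  then show ?thesis by (simp add: h)
qed

text \<open>The two polynomials agree away from -2c by \<open>poly_alpha_YY\<close>; if they
  differed, their difference would have only finitely many roots.\<close>

lemma alpha_YY: "\<alpha> Y Y = [:0, - 2 * coeff (\<alpha> L M) 0:]"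
proof (rule ccontr)
  define q where "q = \<alpha> Y Y - [:0, - 2 * coeff (\<alpha> L M) 0:]"
  assume "\<not> ?thesis"
  then have "finite {l. poly q l = 0}" by (intro poly_roots_finite) (simp add: q_def)
  then obtain l where l: "l \<notin> insert (- 2 * c) {l. poly q l = 0}"
    by (meson ex_new_if_finite finite_insert infinite_UNIV_char_0)
  then have "poly (\<alpha> Y Y) l = - 2 * l * coeff (\<alpha> L M) 0"
    using poly_alpha_YY[of l] arg_cong[OF alpha_LM, of "\<lambda>p. poly p l"]
    by (auto simp: eq_neg_iff_add_eq_0)
  then show False using l by (simp add: q_def)
qed

lemma alpha_YM: "\<alpha> Y M = 0"
proof -
  \<comment> \<open>At l = 0 the two coefficients add up to 3c. Once the multiples of c vanish, m =
    0 leaves half of l times the cocycle.\<close>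
  have c: "c * poly (\<alpha> Y M) m = 0" for m using LYM[of 0 m] by (simp add: algebra_simps)
  then have "l * poly (\<alpha> Y M) l = 0" for l
    using LYM[of l 0] c[of l] c[of 0] by (cases "c = 0") simp_all
  \<comment> \<open>Keeping the factor l as multiplication by the variable avoids a separate
    argument at l = 0.\<close>
  then have "poly (pCons 0 (\<alpha> Y M)) l = 0" for l by simp
  then show ?thesis by (metis pCons_eq_0_iff poly_all_0_iff_0)
qed

lemma alpha_MM: "\<alpha> M M = 0"
proof -
  \<comment> \<open>Here the coefficients at l = 0 add up to 4c, and m = 0 leaves -l times the
    cocycle.\<close>
  have c: "c * poly (\<alpha> M M) m = 0" for m using LMM[of 0 m] by (simp add: algebra_simps)
  then have "l * poly (\<alpha> M M) l = 0" for l
    using LMM[of l 0] c[of l] c[of 0] by (cases "c = 0") simp_all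
  then have "poly (pCons 0 (\<alpha> M M)) l = 0" for l by simp
  then show ?thesis by (metis pCons_eq_0_iff poly_all_0_iff_0)
qed

lemma hat_bracket_YM: "hat_bracket (incl Y) (incl M) = 0"
  and hat_bracket_MM: "hat_bracket (incl M) (incl M) = 0"
  by (simp_all add: hat_bracket_incl YM MM alpha_YM alpha_MM)

end

theorem theorem4p5:
  fixes c :: complex
    and scale :: "complex poly \<Rightarrow> 'r::ab_group_add \<Rightarrow> 'r"
    and bracket :: "'r \<Rightarrow> 'r \<Rightarrow> 'r poly"
    and L M Y :: 'r
    and hat_bracket :: "'r \<times> complex \<Rightarrow> 'r \<times> complex \<Rightarrow> ('r \<times> complex) poly"
    and \<alpha> :: "'r \<Rightarrow> 'r \<Rightarrow> complex poly"
  assumes "TSV scale bracket c L M Y"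
    and "central_extension scale bracket hat_bracket \<alpha>"
  shows "\<exists>a\<^sub>1 a\<^sub>3 b\<^sub>1 c\<^sub>0 :: complex.
      hat_bracket (incl L) (incl L) =
        (dd + 2 * lam) \<odot>\<^bsub>ext_scale scale\<^esub> incl L
        + (cst a\<^sub>1 * lam + cst a\<^sub>3 * lam ^ 3) \<odot>\<^bsub>ext_scale scale\<^esub> cc \<and>
      hat_bracket (incl L) (incl Y) =
        (dd + cst (3/2) * lam + cst c) \<odot>\<^bsub>ext_scale scale\<^esub> incl Y
        + ((cst (2/3 * c) + lam) * cst b\<^sub>1) \<odot>\<^bsub>ext_scale scale\<^esub> cc \<and>
      hat_bracket (incl Y) (incl Y) =
        (- ((dd + 2 * lam) * (dd + cst (2 * c)))) \<odot>\<^bsub>ext_scale scale\<^esub> incl M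
        + (- 2 * cst c\<^sub>0 * lam) \<odot>\<^bsub>ext_scale scale\<^esub> cc \<and>
      hat_bracket (incl L) (incl M) =
        (dd + cst (2 * c)) \<odot>\<^bsub>ext_scale scale\<^esub> incl M
        + cst c\<^sub>0 \<odot>\<^bsub>ext_scale scale\<^esub> cc \<and>
      hat_bracket (incl Y) (incl M) = 0 \<and>
      hat_bracket (incl M) (incl Y) = 0 \<and>
      hat_bracket (incl M) (incl M) = 0 \<and>
      (\<forall>v \<in> {incl L, incl Y, incl M, cc}. hat_bracket cc v = 0 \<and> hat_bracket v cc = 0)"
proof -
  interpret TSV_central_extension scale bracket c L M Y hat_bracket \<alpha>
    using assms by (rule TSV_central_extension.intro)
  define a1 a3 b1 c0 where "a1 = coeff (\<alpha> L L) 1" and "a3 = coeff (\<alpha> L L) 3"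
    and "b1 = coeff (\<alpha> L Y) 1" and "c0 = coeff (\<alpha> L M) 0"
  have "lift (\<alpha> L L) = cst a1 * lam + cst a3 * lam ^ 3"
    by (subst alpha_LL) (simp add: lift_def map_poly_pCons a1_def a3_def power3_eq_cube)
  moreover have "lift (\<alpha> L Y) = (cst (2/3 * c) + lam) * cst b1"
    by (subst alpha_LY) (simp add: lift_def map_poly_pCons b1_def)
  moreover have "lift (\<alpha> Y Y) = - 2 * cst c0 * lam"
    by (subst alpha_YY) (simp add: lift_def map_poly_pCons c0_def numeral_poly)
  moreover have "lift (\<alpha> L M) = cst c0"
    by (subst alpha_LM) (simp add: lift_def map_poly_pCons c0_def)
  moreover have "(dd + 2 * lam) * (- dd - cst (2 * c)) = - ((dd + 2 * lam) * (dd + cst (2 * c)))"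
    by (simp only: mult_minus_right[symmetric] minus_add_distrib diff_conv_add_uminus)
  ultimately show ?thesis
    using hat_bracket_pact[OF LL] hat_bracket_pact[OF LY] hat_bracket_pact[OF YY]
      hat_bracket_pact[OF LM] hat_bracket_YM hat_bracket_MM
      hat_bracket_swap_eq_0[OF hat_bracket_YM] central hat_bracket_swap_eq_0[OF central]
    by (intro exI[of _ a1] exI[of _ a3] exI[of _ b1] exI[of _ c0]) simp
qed

end
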